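(* There exists a function $\ell:\mathbb{N}\to\mathbb{N}$ with $\ell(n)=\Theta(n/\log n)$ such that if $(L,M)$ is a random $\ell(n)$-correspondence assignment for the complete graph $K_n$, then with probability tending to $1$ as $n\to\infty$, $K_n$ is $(L,M)$-colorable.
   Context: A correspondence assignment for a graph $G$ is a pair $(L,M)$ where $L$ assigns to each vertex $v$ a finite list $L(v)$ of colors and $M=\{M_e:e\in E(G)\}$ assigns to each edge $e=uv$ a (not necessarily perfect) matching $M_e$ between $\{u\}\times L(u)$ and $\{v\}\times L(v)$. An $(L,M)$-coloring is a map $\varphi$ with $\varphi(v)\in L(v)$ for all $v$ such that for every edge $e=uv$, $(u,\varphi(u))$ and $(v,\varphi(v))$ are not adjacent in $M_e$. A random $\ell$-correspondence assignment for $G$ is the assignment with $L(v)=\{1,\ldots,\ell\}$ for every vertex $v$, where for each edge $e=uv$ the matching $M_e$ is chosen uniformly at random among the perfect matchings between $\{u\}\times\{1,\ldots,\ell\}$ and $\{v\}\times\{1,\ldots,\ell\}$, independently for different edges. *)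

theory Defs
  imports "HOL-Probability.Probability" "HOL-Library.Landau_Symbols"
begin

text \<open>
  A finite simple graph is given by its vertex set \<open>V :: 'v set\<close> and its edge set
  \<open>E :: 'v set set\<close>, each edge being an unordered pair of distinct vertices of \<open>V\<close>.
\<close>

definition complete_edges :: "'v set \<Rightarrow> 'v set set" where
  "complete_edges V = {{u, v} | u v. u \<in> V \<and> v \<in> V \<and> u \<noteq> v}"

definition matching :: "'a set \<Rightarrow> 'a set \<Rightarrow> 'a set set \<Rightarrow> bool" where
  "matching A B N \<longleftrightarrow> N \<subseteq> {{x, y} | x y. x \<in> A \<and> y \<in> B} \<and> disjoint N"

definition perfect_matching :: "'a set \<Rightarrow> 'a set \<Rightarrow> 'a set set \<Rightarrow> bool" where
  "perfect_matching A B N \<longleftrightarrow> matching A B N \<and> \<Union> N = A \<union> B"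

definition correspondence_assignment ::
    "'v set \<Rightarrow> 'v set set \<Rightarrow> ('v \<Rightarrow> 'c set) \<Rightarrow> ('v set \<Rightarrow> ('v \<times> 'c) set set) \<Rightarrow> bool" where
  "correspondence_assignment V E L M \<longleftrightarrow>
     (\<forall>v\<in>V. finite (L v)) \<and>
     (\<forall>u v. {u, v} \<in> E \<longrightarrow> matching ({u} \<times> L u) ({v} \<times> L v) (M {u, v}))"

definition correspondence_coloring ::
    "'v set \<Rightarrow> 'v set set \<Rightarrow> ('v \<Rightarrow> 'c set) \<Rightarrow> ('v set \<Rightarrow> ('v \<times> 'c) set set) \<Rightarrow> ('v \<Rightarrow> 'c) \<Rightarrow> bool" where
  "correspondence_coloring V E L M \<phi> \<longleftrightarrow>
     (\<forall>v\<in>V. \<phi> v \<in> L v) \<and>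
     (\<forall>u v. {u, v} \<in> E \<longrightarrow> {(u, \<phi> u), (v, \<phi> v)} \<notin> M {u, v})"

definition correspondence_colorable ::
    "'v set \<Rightarrow> 'v set set \<Rightarrow> ('v \<Rightarrow> 'c set) \<Rightarrow> ('v set \<Rightarrow> ('v \<times> 'c) set set) \<Rightarrow> bool" where
  "correspondence_colorable V E L M \<longleftrightarrow> (\<exists>\<phi>. correspondence_coloring V E L M \<phi>)"

text \<open>The set below does not depend on the order in which the two ends of the edge are named.\<close>

definition edge_perfect_matchings :: "('v \<Rightarrow> 'c set) \<Rightarrow> 'v set \<Rightarrow> ('v \<times> 'c) set set set" where
  "edge_perfect_matchings L e =
     {N. \<exists>u v. e = {u, v} \<and> u \<noteq> v \<and> perfect_matching ({u} \<times> L u) ({v} \<times> L v) N}"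

text \<open>
  \<open>Pi_pmf\<close> makes the matchings on distinct edges independent; arguments of \<open>M\<close> that are not
  edges get the irrelevant default value \<open>{}\<close>.
\<close>

definition random_correspondence_assignment ::
    "'v set set \<Rightarrow> nat \<Rightarrow> (('v \<Rightarrow> nat set) \<times> ('v set \<Rightarrow> ('v \<times> nat) set set)) pmf" where
  "random_correspondence_assignment E l =
     map_pmf (Pair (\<lambda>_. {1..l}))
       (Pi_pmf E {} (\<lambda>e. pmf_of_set (edge_perfect_matchings (\<lambda>_. {1..l}) e)))"

lemma matching_commute: "matching A B N \<longleftrightarrow> matching B A N"
proof -
  have "{{x, y} | x y. x \<in> A \<and> y \<in> B} = {{x, y} | x y. x \<in> B \<and> y \<in> A}"
    by (metis insert_commute)
  then show ?thesis by (simp add: matching_def)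
qed

lemma perfect_matching_commute: "perfect_matching A B N \<longleftrightarrow> perfect_matching B A N"
  by (simp add: perfect_matching_def matching_commute Un_commute)

lemma edge_perfect_matchings_eq:
  assumes "u \<noteq> v"
  shows "edge_perfect_matchings L {u, v} = {N. perfect_matching ({u} \<times> L u) ({v} \<times> L v) N}"
  using assms by (auto simp: edge_perfect_matchings_def doubleton_eq_iff perfect_matching_commute)

lemma finite_complete_edges: "finite V \<Longrightarrow> finite (complete_edges V)"
  by (rule finite_subset[of _ "Pow V"]) (auto simp: complete_edges_def)

lemma finite_edge_perfect_matchings:
  assumes "u \<noteq> v" "finite (L u)" "finite (L v)"
  shows "finite (edge_perfect_matchings L {u, v})"
proof (rule finite_subset)
  show "edge_perfect_matchings L {u, v} \<subseteq> Pow (Pow ({u} \<times> L u \<union> {v} \<times> L v))"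
    using assms(1) by (auto simp: edge_perfect_matchings_eq perfect_matching_def)
qed (use assms in auto)

lemma edge_perfect_matchings_nonempty:
  assumes "u \<noteq> v"
  shows "edge_perfect_matchings (\<lambda>_. C) {u, v} \<noteq> {}"
proof -
  have "perfect_matching ({u} \<times> C) ({v} \<times> C) ((\<lambda>c. {(u, c), (v, c)}) ` C)"
    using assms by (auto simp: perfect_matching_def matching_def pairwise_def disjnt_def)
  then show ?thesis
    using assms by (auto simp: edge_perfect_matchings_eq)
qed

lemma random_correspondence_assignment_support:
  assumes "finite V" "(L, M) \<in> set_pmf (random_correspondence_assignment (complete_edges V) l)"
  shows "correspondence_assignment V (complete_edges V) L M"
proof -
  have L: "L = (\<lambda>_. {1..l})"
    and M: "M \<in> PiE_dflt (complete_edges V) {}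
      (set_pmf \<circ> (\<lambda>e. pmf_of_set (edge_perfect_matchings (\<lambda>_. {1..l}) e)))"
    using assms by (auto simp: random_correspondence_assignment_def set_Pi_pmf finite_complete_edges)
  have "matching ({u} \<times> L u) ({v} \<times> L v) (M {u, v})" if e: "{u, v} \<in> complete_edges V" for u v
  proof -
    have uv: "u \<noteq> v" using e by (auto simp: complete_edges_def doubleton_eq_iff)
    have "M {u, v} \<in> set_pmf (pmf_of_set (edge_perfect_matchings (\<lambda>_. {1..l}) {u, v}))"
      using M e by (auto simp: PiE_dflt_def)
    then have "M {u, v} \<in> edge_perfect_matchings (\<lambda>_. {1..l}) {u, v}"
      using uv by (simp add: set_pmf_of_set finite_edge_perfect_matchings edge_perfect_matchings_nonempty)
    then show ?thesis
      using uv by (simp add: L edge_perfect_matchings_eq perfect_matching_def)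
  qed
  then show ?thesis by (simp add: correspondence_assignment_def L)
qed

end

theory Submission
  imports Defs "HOL-Real_Asymp.Real_Asymp"
begin

text \<open>
  Color the vertices greedily. Once a coloring of the earlier vertices is fixed, each earlier vertex
  forbids one uniformly random color at the next vertex, and these choices are independent because
  the edges to the next vertex have not been revealed. So all \<open>l\<close> colors are forbidden only if at
  most \<open>n\<close> random coupons complete a collection of size \<open>l\<close>. By negative correlation this has
  probability at most \<open>(1 - (1 - 1/l)^n)^l\<close>, and with \<open>l\<close> about \<open>4 n / ln n\<close> a union bound over the
  vertices leaves a failure probability of at most \<open>n exp (- 4 sqrt n / ln n)\<close>.
\<close>

section \<open>Tools: conditioning on an independent coordinate, and a power inequality\<close>

text \<open>Tonelli for two independent choices. It justifies revealing some matchings first and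
  bounding the conditional probability for each outcome.\<close>

lemma measure_pair_pmf_eq_expectation:
  "measure_pmf.prob (pair_pmf p q) A =
     measure_pmf.expectation p (\<lambda>a. measure_pmf.prob q {b. (a, b) \<in> A})"
proof -
  have "ennreal (measure_pmf.prob (pair_pmf p q) A) = (\<integral>\<^sup>+x. indicator A x \<partial>pair_pmf p q)"
    by (simp add: measure_pmf.emeasure_eq_measure)
  also have "\<dots> = (\<integral>\<^sup>+a. \<integral>\<^sup>+b. indicator {b. (a, b) \<in> A} b \<partial>q \<partial>p)"
    by (simp add: nn_integral_pair_pmf' indicator_def)
  also have "\<dots> = (\<integral>\<^sup>+a. ennreal (measure_pmf.prob q {b. (a, b) \<in> A}) \<partial>p)"
    by (simp add: measure_pmf.emeasure_eq_measure)
  also have "\<dots> = ennreal (measure_pmf.expectation p (\<lambda>a. measure_pmf.prob q {b. (a, b) \<in> A}))"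
    by (intro nn_integral_eq_integral measure_pmf.integrable_const_bound[of _ 1]) auto
  finally show ?thesis
    by simp
qed

text \<open>These are the terms of order at most one in \<open>h\<close> of the binomial expansion,
  and the other terms are nonnegative. The induction multiplies by \<open>p + h\<close> and drops
  the second-order term \<open>X * h\<close>. The truncated exponent \<open>s - 1\<close> does no
  harm at \<open>s = 0\<close>, where its coefficient vanishes.\<close>

lemma power_add_ge:
  fixes p h :: real
  assumes "0 \<le> p" "0 \<le> h"
  shows "p ^ s + real s * h * p ^ (s - 1) \<le> (p + h) ^ s"
proof (induction s)
  case (Suc s)
  define X where "X = real s * h * p ^ (s - 1)"
  have "X * p = real s * h * p ^ s"
    by (cases s) (auto simp: X_def)
  then have "(p ^ s + X) * (p + h) = p ^ Suc s + real (Suc s) * h * p ^ s + X * h"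
    by (simp add: algebra_simps)
  moreover have "(p ^ s + X) * (p + h) \<le> (p + h) ^ s * (p + h)"
    using Suc assms unfolding X_def by (intro mult_right_mono) auto
  moreover have "0 \<le> X * h"
    using assms by (simp add: X_def)
  ultimately show ?case
    by (simp add: mult.commute)
qed auto

section \<open>Uniform perfect matchings\<close>

text \<open>Covering gives \<open>(u, a)\<close> a partner, and disjointness of the edges makes it
  unique. So each earlier vertex, once colored, forbids exactly one color at the next
  vertex.\<close>

lemma perfect_matching_partner:
  assumes "perfect_matching ({u} \<times> C) ({v} \<times> C) N" "u \<noteq> v" "a \<in> C"
  shows "\<exists>c\<in>C. \<forall>c'. {(u, a), (v, c')} \<in> N \<longleftrightarrow> c' = c"
proof -
  have sub: "N \<subseteq> {{x, y} | x y. x \<in> {u} \<times> C \<and> y \<in> {v} \<times> C}" and dis: "disjoint N"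
    and cover: "\<Union> N = {u} \<times> C \<union> {v} \<times> C"
    using assms(1) by (auto simp: perfect_matching_def matching_def)
  obtain e where e: "e \<in> N" "(u, a) \<in> e"
    using cover assms(3) by blast
  obtain b c where "e = {(u, b), (v, c)}" "c \<in> C"
    using sub e by blast
  then have c: "{(u, a), (v, c)} \<in> N"
    using e assms(2) by auto
  have "c' = c" if "{(u, a), (v, c')} \<in> N" for c'
  proof -
    have "{(u, a), (v, c')} = {(u, a), (v, c)}"
    proof (rule ccontr)
      assume "{(u, a), (v, c')} \<noteq> {(u, a), (v, c)}"
      then have "disjnt {(u, a), (v, c')} {(u, a), (v, c)}"
        by (rule pairwiseD[OF dis that c])
      then show False
        by (simp add: disjnt_def)
    qed
    then show ?thesis
      by (auto simp: doubleton_eq_iff)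
  qed
  then show ?thesis
    using c \<open>c \<in> C\<close> by blast
qed

lemma perfect_matching_image:
  assumes "perfect_matching A B N" "bij \<sigma>" "\<sigma> ` A = A" "\<sigma> ` B = B"
  shows "perfect_matching A B ((`) \<sigma> ` N)"
proof -
  have sub: "N \<subseteq> {{x, y} | x y. x \<in> A \<and> y \<in> B}" and dis: "disjoint N" and cover: "\<Union> N = A \<union> B"
    using assms(1) by (auto simp: perfect_matching_def matching_def)
  have "(`) \<sigma> ` N \<subseteq> {{x, y} | x y. x \<in> A \<and> y \<in> B}"
  proof
    fix e assume "e \<in> (`) \<sigma> ` N"
    then obtain x y where "x \<in> A" "y \<in> B" "e = {\<sigma> x, \<sigma> y}"
      using sub by blast
    moreover have "\<sigma> x \<in> A" "\<sigma> y \<in> B"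
      using assms(3,4) \<open>x \<in> A\<close> \<open>y \<in> B\<close> by auto
    ultimately show "e \<in> {{x, y} | x y. x \<in> A \<and> y \<in> B}"
      by blast
  qed
  moreover have "disjoint ((`) \<sigma> ` N)"
    using dis assms(2) by (intro disjoint_image) (auto intro: inj_on_subset dest: bij_is_inj)
  moreover have "\<Union> ((`) \<sigma> ` N) = A \<union> B"
    using cover assms(3,4) by (metis image_Un image_Union)
  ultimately show ?thesis
    by (simp add: perfect_matching_def matching_def)
qed

text \<open>The symmetry behind uniformity: two colors are exchanged at \<open>v\<close> and every
  other vertex is left alone. Being an involution, it serves as its own inverse in the bijections
  below.\<close>

definition colour_swap :: "'v \<Rightarrow> 'c \<Rightarrow> 'c \<Rightarrow> 'v \<times> 'c \<Rightarrow> 'v \<times> 'c" where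
  "colour_swap v c c' = (\<lambda>(w, d). (w, if w = v then Transposition.transpose c c' d else d))"

lemma colour_swap_involutory [simp]: "colour_swap v c c' (colour_swap v c c' x) = x"
  by (auto simp: colour_swap_def split: prod.splits)

lemma colour_swap_image:
  assumes "c \<in> C" "c' \<in> C"
  shows "colour_swap v c c' ` ({w} \<times> C) = {w} \<times> C"
proof (rule antisym)
  show *: "colour_swap v c c' ` ({w} \<times> C) \<subseteq> {w} \<times> C"
    using assms by (auto simp: colour_swap_def Transposition.transpose_def)
  show "{w} \<times> C \<subseteq> colour_swap v c c' ` ({w} \<times> C)"
    using image_mono[OF *, of "colour_swap v c c'"] by (simp add: image_image)
qed

text \<open>Swapping \<open>c\<close> and \<open>c'\<close> at \<open>v\<close> permutes the perfect
  matchings and carries those through \<open>{(u, a), (v, c)}\<close> onto those through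
  \<open>{(u, a), (v, c')}\<close>.\<close>

lemma card_matchings_through_eq:
  assumes "u \<noteq> v" "c \<in> C" "c' \<in> C"
  defines "P \<equiv> edge_perfect_matchings (\<lambda>_. C) {u, v}"
  shows "card {N \<in> P. {(u, a), (v, c)} \<in> N} = card {N \<in> P. {(u, a), (v, c')} \<in> N}"
proof -
  define \<sigma> where "\<sigma> = colour_swap v c c'"
  have inv: "(`) \<sigma> ` (`) \<sigma> ` N = N" for N
    by (simp add: image_image \<sigma>_def)
  have "bij \<sigma>"
    by (rule o_bij[of \<sigma>]) (auto simp: \<sigma>_def)
  have image: "\<sigma> ` ({w} \<times> C) = {w} \<times> C" for w
    unfolding \<sigma>_def using assms(2,3) by (rule colour_swap_image)
  have P_iff: "N \<in> P \<longleftrightarrow> perfect_matching ({u} \<times> C) ({v} \<times> C) N" for N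
    using assms(1) by (simp add: P_def edge_perfect_matchings_eq)
  have P: "(`) \<sigma> ` N \<in> P" if "N \<in> P" for N
    using that unfolding P_iff by (rule perfect_matching_image[OF _ \<open>bij \<sigma>\<close> image image])
  have \<sigma>: "\<sigma> ` {(u, a), (v, c)} = {(u, a), (v, c')}" "\<sigma> ` {(u, a), (v, c')} = {(u, a), (v, c)}"
    using assms(1) by (auto simp: \<sigma>_def colour_swap_def)
  have "bij_betw (\<lambda>N. (`) \<sigma> ` N) {N \<in> P. {(u, a), (v, c)} \<in> N} {N \<in> P. {(u, a), (v, c')} \<in> N}"
  proof (rule bij_betw_byWitness[where f' = "\<lambda>N. (`) \<sigma> ` N"])
    show "(\<lambda>N. (`) \<sigma> ` N) ` {N \<in> P. {(u, a), (v, c)} \<in> N} \<subseteq> {N \<in> P. {(u, a), (v, c')} \<in> N}"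
      using P imageI[of "{(u, a), (v, c)}" _ "(`) \<sigma>"] unfolding \<sigma>(1) by blast
    show "(\<lambda>N. (`) \<sigma> ` N) ` {N \<in> P. {(u, a), (v, c')} \<in> N} \<subseteq> {N \<in> P. {(u, a), (v, c)} \<in> N}"
      using P imageI[of "{(u, a), (v, c')}" _ "(`) \<sigma>"] unfolding \<sigma>(2) by blast
  qed (simp_all add: inv)
  then show ?thesis
    by (rule bij_betw_same_card)
qed

text \<open>The partner of \<open>(u, a)\<close> splits the perfect matchings into classes
  \<open>Q d\<close>, one for each color \<open>d\<close>. By the swap symmetry all classes have the
  same size, so each carries a fraction \<open>1 / card C\<close>.\<close>

lemma prob_matching_through:
  fixes u v :: 'v and C :: "'c set"
  assumes "u \<noteq> v" "finite C" "a \<in> C" "c \<in> C"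
  shows "measure_pmf.prob (pmf_of_set (edge_perfect_matchings (\<lambda>_. C) {u, v}))
           {N. {(u, a), (v, c)} \<in> N} = 1 / real (card C)"
proof -
  define P where "P = edge_perfect_matchings (\<lambda>_. C) {u, v}"
  have fin: "finite P" and ne: "P \<noteq> {}"
    using assms by (auto simp: P_def finite_edge_perfect_matchings edge_perfect_matchings_nonempty)
  define Q where "Q = (\<lambda>d. {N \<in> P. {(u, a), (v, d)} \<in> N})"
  have partner: "\<exists>d\<in>C. \<forall>d'. {(u, a), (v, d')} \<in> N \<longleftrightarrow> d' = d" if "N \<in> P" for N
    using that assms perfect_matching_partner[of u C v N a]
    by (auto simp: P_def edge_perfect_matchings_eq)
  have "P = (\<Union>d\<in>C. Q d)"
    using partner by (fastforce simp: Q_def)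
  moreover have "card (\<Union>d\<in>C. Q d) = (\<Sum>d\<in>C. card (Q d))"
  proof (rule card_UN_disjoint)
    show "\<forall>i\<in>C. \<forall>j\<in>C. i \<noteq> j \<longrightarrow> Q i \<inter> Q j = {}"
    proof (intro ballI impI)
      fix i j :: 'c assume "i \<noteq> j"
      then have "N \<notin> Q i \<inter> Q j" for N
        using partner[of N] by (auto simp: Q_def)
      then show "Q i \<inter> Q j = {}"
        by blast
    qed
  qed (use fin assms in \<open>auto simp: Q_def\<close>)
  moreover have "card (Q d) = card (Q c)" if "d \<in> C" for d
    unfolding Q_def P_def using assms that by (intro card_matchings_through_eq) auto
  ultimately have "card P = card C * card (Q c)"
    by simp
  moreover have "card P > 0"
    using fin ne by (simp add: card_gt_0_iff)
  moreover have "measure_pmf.prob (pmf_of_set P) {N. {(u, a), (v, c)} \<in> N} =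
      real (card (Q c)) / real (card P)"
    using fin ne by (simp add: measure_pmf_of_set Int_def Q_def)
  moreover have "card (Q c) \<noteq> 0"
    using calculation by (metis mult_0_right less_irrefl)
  ultimately show ?thesis
    by (simp flip: P_def)
qed

section \<open>Extending a coloring by one vertex\<close>

abbreviation uniform_matchings :: "nat \<Rightarrow> 'v set \<Rightarrow> ('v \<times> nat) set set pmf" where
  "uniform_matchings l e \<equiv> pmf_of_set (edge_perfect_matchings (\<lambda>_. {1..l}) e)"

text \<open>
  The bound for sets \<open>S\<close> of arbitrary size makes the induction work: revealing one more matching
  shrinks \<open>S\<close> by one color with probability \<open>card S / l\<close>, and \<open>power_add_ge\<close> absorbs the loss.
\<close>

lemma prob_all_blocked_le:
  fixes l :: nat and v :: 'v
  defines "p m \<equiv> 1 - (1 - 1 / real l) ^ m"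
  assumes "finite J" "v \<notin> J" "\<And>u. u \<in> J \<Longrightarrow> \<phi> u \<in> {1..l}" "l \<ge> 1" "S \<subseteq> {1..l}"
  shows "measure_pmf.prob (Pi_pmf ((\<lambda>u. {u, v}) ` J) {} (uniform_matchings l))
           {M. \<forall>c\<in>S. \<exists>u\<in>J. {(u, \<phi> u), (v, c)} \<in> M {u, v}} \<le> p (card J) ^ card S"
  using assms(2,3,4,6)
proof (induction J arbitrary: S rule: finite_induct)
  case empty
  \<comment> \<open>With nothing revealed, the event holds exactly when \<open>S\<close> is empty.
    This agrees with the bound, since \<open>p 0 = 0\<close> and \<open>0 ^ 0 = 1\<close>.\<close>
  then show ?case
    by (cases "S = {}") (auto simp: p_def finite_subset)
next
  case (insert w J)
  let ?E = "(\<lambda>u. {u, v}) ` J" and ?D = "uniform_matchings l {w, v}"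
  \<comment> \<open>The colors of \<open>S\<close> that \<open>w\<close> forbids when its matching
    to \<open>v\<close> is \<open>N\<close>; almost surely there is at most one.\<close>
  define T where "T N = {c \<in> S. {(w, \<phi> w), (v, c)} \<in> N}" for N
  define s where "s = card S"
  define q where "q = p (card J)"
  have wv: "w \<noteq> v" and \<phi>w: "\<phi> w \<in> {1..l}"
    using insert.prems by auto
  have q: "0 \<le> q" "q \<le> 1"
    using \<open>l \<ge> 1\<close> by (auto simp: q_def p_def power_le_one)
  have finS: "finite S"
    using insert.prems(3) finite_subset by blast
  have notin: "{w, v} \<notin> ?E"
    using insert.hyps wv by (auto simp: doubleton_eq_iff)
  have set_D: "set_pmf ?D = edge_perfect_matchings (\<lambda>_. {1..l}) {w, v}"
    using wv by (simp add: set_pmf_of_set finite_edge_perfect_matchings edge_perfect_matchings_nonempty)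
  have fin_D: "finite (set_pmf ?D)"
    unfolding set_D using wv by (simp add: finite_edge_perfect_matchings)
  \<comment> \<open>Split off the matching \<open>N\<close> on \<open>{w, v}\<close>, which is
    independent of the rest. The vertices of \<open>J\<close> then only have to block the colors in
    \<open>S - T N\<close>.\<close>
  have "measure_pmf.prob (Pi_pmf ((\<lambda>u. {u, v}) ` insert w J) {} (uniform_matchings l))
           {M. \<forall>c\<in>S. \<exists>u\<in>insert w J. {(u, \<phi> u), (v, c)} \<in> M {u, v}} =
        measure_pmf.prob (pair_pmf ?D (Pi_pmf ?E {} (uniform_matchings l)))
          {(N, M). \<forall>c\<in>S - T N. \<exists>u\<in>J. {(u, \<phi> u), (v, c)} \<in> M {u, v}}"
  proof -
    have "{w, v} \<noteq> {u, v}" if "u \<in> J" for u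
      using notin that by auto
    then have upd: "(M({w, v} := N)) {u, v} = M {u, v}" if "u \<in> J" for M N u
      using that by (metis fun_upd_other)
    have "(\<exists>u\<in>insert w J. {(u, \<phi> u), (v, c)} \<in> (M({w, v} := N)) {u, v}) \<longleftrightarrow>
        {(w, \<phi> w), (v, c)} \<in> N \<or> (\<exists>u\<in>J. {(u, \<phi> u), (v, c)} \<in> M {u, v})" for M N c
    proof -
      have "(\<exists>u\<in>J. {(u, \<phi> u), (v, c)} \<in> (M({w, v} := N)) {u, v}) \<longleftrightarrow>
          (\<exists>u\<in>J. {(u, \<phi> u), (v, c)} \<in> M {u, v})"
        by (rule bex_cong[OF refl]) (simp only: upd)
      then show ?thesis
        by (simp only: Set.bex_simps(5) fun_upd_same)
    qed
    then have "(\<forall>c\<in>S. \<exists>u\<in>insert w J. {(u, \<phi> u), (v, c)} \<in> (M({w, v} := N)) {u, v}) \<longleftrightarrow>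
        (\<forall>c\<in>S - T N. \<exists>u\<in>J. {(u, \<phi> u), (v, c)} \<in> M {u, v})" for M N
      unfolding T_def by blast
    then show ?thesis
      using notin insert.hyps
      by (simp add: Pi_pmf_insert vimage_def case_prod_unfold del: fun_upd_apply)
  qed
  also have "\<dots> = measure_pmf.expectation ?D (\<lambda>N. measure_pmf.prob (Pi_pmf ?E {} (uniform_matchings l))
          {M. \<forall>c\<in>S - T N. \<exists>u\<in>J. {(u, \<phi> u), (v, c)} \<in> M {u, v}})"
    by (simp add: measure_pair_pmf_eq_expectation)
  \<comment> \<open>The induction hypothesis gives \<open>q ^ s\<close> or
    \<open>q ^ (s - 1)\<close>, according to whether \<open>w\<close> misses or hits
    \<open>S\<close>. At most one indicator in the sum is 1, so both cases are values of one affine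
    expression, whose expectation follows by linearity.\<close>
  also have "\<dots> \<le> measure_pmf.expectation ?D
      (\<lambda>N. q ^ s + (q ^ (s - 1) - q ^ s) * (\<Sum>c\<in>S. indicator {N. {(w, \<phi> w), (v, c)} \<in> N} N))"
  proof (rule integral_mono_AE)
    show "AE N in ?D. measure_pmf.prob (Pi_pmf ?E {} (uniform_matchings l))
          {M. \<forall>c\<in>S - T N. \<exists>u\<in>J. {(u, \<phi> u), (v, c)} \<in> M {u, v}}
        \<le> q ^ s + (q ^ (s - 1) - q ^ s) * (\<Sum>c\<in>S. indicator {N. {(w, \<phi> w), (v, c)} \<in> N} N)"
    proof (rule AE_pmfI)
      fix N assume "N \<in> set_pmf ?D"
      then have "perfect_matching ({w} \<times> {1..l}) ({v} \<times> {1..l}) N"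
        unfolding set_D by (simp add: edge_perfect_matchings_eq[OF wv])
      then obtain c where "\<And>c'. {(w, \<phi> w), (v, c')} \<in> N \<longleftrightarrow> c' = c"
        using wv \<phi>w perfect_matching_partner[of w "{1..l}" v N "\<phi> w"]
        by blast
      then have "T N = S \<inter> {c}" and "\<And>c'. N \<in> {N. {(w, \<phi> w), (v, c')} \<in> N} \<longleftrightarrow> c' = c"
        by (auto simp: T_def)
      then have "q ^ card (S - T N) =
          q ^ s + (q ^ (s - 1) - q ^ s) * (\<Sum>c\<in>S. indicator {N. {(w, \<phi> w), (v, c)} \<in> N} N)"
        using finS by (cases "c \<in> S") (simp_all add: s_def indicator_def Diff_Int)
      moreover have "measure_pmf.prob (Pi_pmf ?E {} (uniform_matchings l))
          {M. \<forall>c\<in>S - T N. \<exists>u\<in>J. {(u, \<phi> u), (v, c)} \<in> M {u, v}} \<le> q ^ card (S - T N)"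
        unfolding q_def using insert.prems by (intro insert.IH) auto
      ultimately show "measure_pmf.prob (Pi_pmf ?E {} (uniform_matchings l))
          {M. \<forall>c\<in>S - T N. \<exists>u\<in>J. {(u, \<phi> u), (v, c)} \<in> M {u, v}}
        \<le> q ^ s + (q ^ (s - 1) - q ^ s) * (\<Sum>c\<in>S. indicator {N. {(w, \<phi> w), (v, c)} \<in> N} N)"
        by simp
    qed
  qed (rule integrable_measure_pmf_finite[OF fin_D] | simp)+
  also have "\<dots> = q ^ s + (q ^ (s - 1) - q ^ s) * (\<Sum>c\<in>S. measure_pmf.prob ?D {N. {(w, \<phi> w), (v, c)} \<in> N})"
    using fin_D by (simp add: integrable_measure_pmf_finite)
  also have "\<dots> = q ^ s + (q ^ (s - 1) - q ^ s) * (\<Sum>c\<in>S. 1 / real l)"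
  proof -
    have "measure_pmf.prob ?D {N. {(w, \<phi> w), (v, c)} \<in> N} = 1 / real l" if "c \<in> S" for c
      using prob_matching_through[of w v "{1..l}" "\<phi> w" c] wv \<phi>w insert.prems(3) that by auto
    then show ?thesis
      by simp
  qed
  also have "\<dots> = q ^ s + real s * ((1 - q) / real l) * q ^ (s - 1)"
  proof -
    \<comment> \<open>For \<open>s = 0\<close> the subtraction \<open>s - 1\<close> truncates, and
      both sides are 0.\<close>
    have "(q ^ (s - 1) - q ^ s) * real s = real s * (1 - q) * q ^ (s - 1)"
      by (cases s) (simp_all add: algebra_simps)
    then show ?thesis
      by (simp flip: s_def)
  qed
  also have "\<dots> \<le> (q + (1 - q) / real l) ^ s"
    using q by (intro power_add_ge) auto
  \<comment> \<open>The complement \<open>1 - q\<close> is multiplied by \<open>1 - 1 / l\<close>,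
    which is how \<open>p\<close> passes from \<open>card J\<close> to
    \<open>card J + 1\<close>.\<close>
  also have "q + (1 - q) / real l = p (card (insert w J))"
    using insert.hyps by (simp add: q_def p_def algebra_simps)
  finally show ?case
    by (simp add: s_def)
qed

section \<open>Adding the vertices one at a time: the union bound\<close>

lemma complete_edges_insert:
  "v \<notin> V \<Longrightarrow> complete_edges (insert v V) = complete_edges V \<union> (\<lambda>u. {u, v}) ` V"
  by (auto simp: complete_edges_def)

lemma correspondence_colorable_insert:
  assumes "v \<notin> V" "c \<in> L v"
    and "correspondence_coloring V (complete_edges V) L M \<phi>"
    and "\<And>u. u \<in> V \<Longrightarrow> {(u, \<phi> u), (v, c)} \<notin> M {u, v}"
  shows "correspondence_colorable (insert v V) (complete_edges (insert v V)) L M"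
proof -
  have "correspondence_coloring (insert v V) (complete_edges (insert v V)) L M (\<phi>(v := c))"
    unfolding correspondence_coloring_def
  proof (intro conjI allI impI ballI)
    fix x y assume "{x, y} \<in> complete_edges (insert v V)"
    then consider "{x, y} \<in> complete_edges V" | "x \<in> V" "y = v" | "y \<in> V" "x = v"
      using assms(1) by (auto simp: complete_edges_insert doubleton_eq_iff)
    then show "{(x, (\<phi>(v := c)) x), (y, (\<phi>(v := c)) y)} \<notin> M {x, y}"
    proof cases
      case 1
      then have "x \<noteq> v" "y \<noteq> v"
        using assms(1) by (auto simp: complete_edges_def doubleton_eq_iff)
      then show ?thesis
        using 1 assms(3) by (auto simp: correspondence_coloring_def)
    next
      case 2
      then show ?thesis
        using assms(1,4) by auto
    next
      case 3
      then have "y \<noteq> v"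
        using assms(1) by auto
      then show ?thesis
        using 3 assms(4)[of y] by (simp add: insert_commute)
    qed
  qed (use assms in \<open>auto simp: correspondence_coloring_def\<close>)
  then show ?thesis
    by (auto simp: correspondence_colorable_def)
qed

lemma correspondence_coloring_cong:
  assumes "\<And>e. e \<in> E \<Longrightarrow> M e = M' e"
  shows "correspondence_coloring V E L M = correspondence_coloring V E L M'"
  using assms by (auto simp: correspondence_coloring_def fun_eq_iff)

abbreviation not_colorable :: "'v set \<Rightarrow> nat \<Rightarrow> ('v set \<Rightarrow> ('v \<times> nat) set set) set" where
  "not_colorable V l \<equiv> {M. \<not> correspondence_colorable V (complete_edges V) (\<lambda>_. {1..l}) M}"

text \<open>A union bound in the form of an induction on \<open>V\<close>: each new vertex adds at
  most \<open>r\<close> to the failure probability. The exponent is \<open>n\<close> rather than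
  \<open>card V\<close>, so that \<open>r\<close> is the same at every step.\<close>

lemma prob_not_colorable_le:
  fixes l n :: nat and V :: "'a set"
  defines "r \<equiv> (1 - (1 - 1 / real l) ^ n) ^ l"
  assumes "finite V" "card V \<le> n" "l \<ge> 1"
  shows "measure_pmf.prob (Pi_pmf (complete_edges V) {} (uniform_matchings l)) (not_colorable V l)
           \<le> real (card V) * r"
  using assms(2,3)
proof (induction V rule: finite_induct)
  case empty
  \<comment> \<open>The color 0 lies outside the lists, but on the empty graph any map is a
    coloring.\<close>
  have "correspondence_coloring {} (complete_edges {}) (\<lambda>_. {1..l}) M (\<lambda>_. 0)" for M :: "'a set \<Rightarrow> _"
    unfolding correspondence_coloring_def complete_edges_def by blast
  then have "not_colorable ({} :: 'a set) l = {}"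
    unfolding correspondence_colorable_def by blast
  then show ?case
    by (simp only: measure_empty card.empty of_nat_0 mult_zero_left order_refl)
next
  case (insert v V)
  let ?E = "complete_edges V" and ?F = "(\<lambda>u. {u, v}) ` V"
  let ?P = "Pi_pmf ?E {} (uniform_matchings l)" and ?Q = "Pi_pmf ?F {} (uniform_matchings l)"
  let ?join = "\<lambda>f g x. if x \<in> ?E then f x else g x"
  have r: "0 \<le> r"
    using \<open>l \<ge> 1\<close> by (auto simp: r_def power_le_one)
  have disj: "?E \<inter> ?F = {}"
    using insert.hyps by (auto simp: complete_edges_def doubleton_eq_iff)
  \<comment> \<open>Condition on the matchings \<open>f\<close> inside \<open>V\<close>. If they
    admit no coloring, the indicator already pays for the trivial bound 1. Otherwise fix a coloring
    \<phi> that depends on \<open>f\<close> only; the matchings \<open>g\<close> at \<open>v\<close>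
    are independent of it, so \<open>prob_all_blocked_le\<close> applies with all \<open>l\<close>
    colors as \<open>S\<close>.\<close>
  have fiber: "measure_pmf.prob ?Q {g. ?join f g \<in> not_colorable (insert v V) l}
      \<le> indicator (not_colorable V l) f + r" for f
  proof (cases "f \<in> not_colorable V l")
    case True
    then show ?thesis
      using r by (simp add: add_increasing2)
  next
    case False
    then obtain \<phi> where \<phi>: "correspondence_coloring V ?E (\<lambda>_. {1..l}) f \<phi>"
      by (auto simp: correspondence_colorable_def)
    have "{g. ?join f g \<in> not_colorable (insert v V) l} \<subseteq>
        {g. \<forall>c\<in>{1..l}. \<exists>u\<in>V. {(u, \<phi> u), (v, c)} \<in> g {u, v}}"
    proof (intro subsetI CollectI ballI, rule ccontr)
      fix g c
      assume nc: "g \<in> {g. ?join f g \<in> not_colorable (insert v V) l}"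
        and c: "c \<in> {1..l}" and free: "\<not> (\<exists>u\<in>V. {(u, \<phi> u), (v, c)} \<in> g {u, v})"
      have "correspondence_colorable (insert v V) (complete_edges (insert v V))
              (\<lambda>_. {1..l}) (?join f g)"
      proof (rule correspondence_colorable_insert[OF insert.hyps(2) c])
        show "correspondence_coloring V ?E (\<lambda>_. {1..l}) (?join f g) \<phi>"
          using \<phi> correspondence_coloring_cong[of ?E f "?join f g"] by simp
        fix u assume "u \<in> V"
        then have "{u, v} \<notin> ?E"
          using disj by blast
        then have "?join f g {u, v} = g {u, v}"
          by (rule if_not_P)
        then show "{(u, \<phi> u), (v, c)} \<notin> ?join f g {u, v}"
          using free \<open>u \<in> V\<close> by metis
      qed
      then show False
        using nc by blast
    qed
    then have "measure_pmf.prob ?Q {g. ?join f g \<in> not_colorable (insert v V) l}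
        \<le> measure_pmf.prob ?Q {g. \<forall>c\<in>{1..l}. \<exists>u\<in>V. {(u, \<phi> u), (v, c)} \<in> g {u, v}}"
      by (intro measure_pmf.finite_measure_mono) auto
    also have "\<dots> \<le> (1 - (1 - 1 / real l) ^ card V) ^ card {1..l}"
      using insert.hyps \<phi> \<open>l \<ge> 1\<close>
      by (intro prob_all_blocked_le) (auto simp: correspondence_coloring_def)
    \<comment> \<open>More earlier vertices only weaken the bound, so \<open>card V\<close> may be
      replaced by \<open>n\<close>.\<close>
    also have "\<dots> \<le> r"
      using insert.hyps insert.prems \<open>l \<ge> 1\<close> unfolding r_def
      by (auto intro!: power_mono power_decreasing diff_left_mono simp: power_le_one)
    finally show ?thesis
      using False by simp
  qed
  have "measure_pmf.prob (Pi_pmf (complete_edges (insert v V)) {} (uniform_matchings l))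
          (not_colorable (insert v V) l) =
        measure_pmf.prob (pair_pmf ?P ?Q) {(f, g). ?join f g \<in> not_colorable (insert v V) l}"
  proof -
    have "Pi_pmf (complete_edges (insert v V)) {} (uniform_matchings l) =
        map_pmf (\<lambda>(f, g). ?join f g) (pair_pmf ?P ?Q)"
      unfolding complete_edges_insert[OF insert.hyps(2)]
      using insert.hyps(1) disj by (intro Pi_pmf_union finite_complete_edges finite_imageI)
    then show ?thesis
      by (simp only: measure_map_pmf vimage_def case_prod_unfold)
  qed
  also have "\<dots> = measure_pmf.expectation ?P
      (\<lambda>f. measure_pmf.prob ?Q {g. ?join f g \<in> not_colorable (insert v V) l})"
    by (simp add: measure_pair_pmf_eq_expectation)
  also have "\<dots> \<le> measure_pmf.expectation ?P (\<lambda>f. indicator (not_colorable V l) f + r)"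
  proof (rule integral_mono)
    show "integrable ?P (\<lambda>f. measure_pmf.prob ?Q {g. ?join f g \<in> not_colorable (insert v V) l})"
      by (rule measure_pmf.integrable_const_bound[of _ 1]) auto
    show "integrable ?P (\<lambda>f. indicator (not_colorable V l) f + r)"
      by (rule measure_pmf.integrable_const_bound[of _ "1 + r"]) (use r in \<open>auto simp: indicator_def\<close>)
  qed (rule fiber)
  also have "\<dots> = measure_pmf.prob ?P (not_colorable V l) + r"
  proof -
    have "integrable ?P (indicator (not_colorable V l) :: _ \<Rightarrow> real)"
      by (rule measure_pmf.integrable_const_bound[of _ 1]) auto
    then show ?thesis
      by (subst Bochner_Integration.integral_add) auto
  qed
  also have "\<dots> \<le> real (card V) * r + r"
    using insert by simp
  finally show ?case
    using insert.hyps by (simp add: algebra_simps)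
qed

section \<open>Asymptotics\<close>

text \<open>The union bound is made exponential by two estimates:
  \<open>1 - x \<ge> exp (- 2 * x)\<close> for \<open>0 \<le> x \<le> 1 / 2\<close>, which is where
  \<open>l \<ge> 2\<close> enters, and \<open>1 - y \<le> exp (- y)\<close> with
  \<open>y = (1 - x) ^ n\<close>.\<close>

lemma prob_colorable_ge:
  assumes "l \<ge> 2"
  shows "measure_pmf.prob (random_correspondence_assignment (complete_edges {1..n}) l)
           {(L, M). correspondence_colorable {1..n} (complete_edges {1..n}) L M}
         \<ge> 1 - real n * exp (- real l * exp (- 2 * real n / real l))"
proof -
  let ?P = "Pi_pmf (complete_edges {1..n}) {} (uniform_matchings l)"
  define x where "x = 1 / real l"
  have x: "0 \<le> x" "x \<le> 1 / 2"
    using assms by (auto simp: x_def field_simps)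
  \<comment> \<open>Equivalent to \<open>2 * x * x \<le> x\<close>, which follows from
    \<open>x \<le> 1 / 2\<close>; the right side is a standard lower bound for
    \<open>ln (1 - x)\<close>.\<close>
  have "- 2 * x \<le> - x - 2 * x\<^sup>2"
    using mult_left_mono[OF x(2) x(1)] by (simp add: power2_eq_square)
  also have "\<dots> \<le> ln (1 - x)"
    using x by (rule ln_one_minus_pos_lower_bound)
  finally have "exp (- 2 * x) \<le> 1 - x"
    using x by (simp add: ln_ge_iff)
  then have "exp (- 2 * x) ^ n \<le> (1 - x) ^ n"
    by (rule power_mono) simp
  then have "exp (- 2 * real n / real l) \<le> (1 - x) ^ n"
    by (simp add: x_def field_simps flip: exp_of_nat_mult)
  moreover have "1 - (1 - x) ^ n \<le> exp (- ((1 - x) ^ n))"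
    using exp_ge_add_one_self[of "- ((1 - x) ^ n)"] by simp
  ultimately have "1 - (1 - x) ^ n \<le> exp (- exp (- 2 * real n / real l))"
    by (smt (verit) exp_le_cancel_iff)
  then have "(1 - (1 - x) ^ n) ^ l \<le> exp (- exp (- 2 * real n / real l)) ^ l"
    using x by (intro power_mono) (auto simp: power_le_one)
  also have "\<dots> = exp (- real l * exp (- 2 * real n / real l))"
    by (simp flip: exp_of_nat_mult)
  finally have "real n * (1 - (1 - x) ^ n) ^ l \<le> real n * exp (- real l * exp (- 2 * real n / real l))"
    by (intro mult_left_mono) auto
  moreover have "measure_pmf.prob ?P (not_colorable {1..n} l) \<le> real n * (1 - (1 - x) ^ n) ^ l"
    using prob_not_colorable_le[of "{1..n}" n l] assms by (simp add: x_def)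
  moreover have "measure_pmf.prob (random_correspondence_assignment (complete_edges {1..n}) l)
           {(L, M). correspondence_colorable {1..n} (complete_edges {1..n}) L M} =
        measure_pmf.prob ?P (- not_colorable {1..n} l)"
    unfolding random_correspondence_assignment_def measure_map_pmf
    by (rule arg_cong[where f = "measure_pmf.prob _"]) auto
  moreover have "measure_pmf.prob ?P (- not_colorable {1..n} l) =
        1 - measure_pmf.prob ?P (not_colorable {1..n} l)"
    using measure_pmf.prob_compl[of "not_colorable {1..n} l" ?P] by (simp add: Compl_eq_Diff_UNIV)
  ultimately show ?thesis
    by linarith
qed

theorem theorem3:
  shows "\<exists>l :: nat \<Rightarrow> nat.
    (\<lambda>n. real (l n)) \<in> \<Theta>(\<lambda>n. real n / ln (real n)) \<and>
    (\<lambda>n. measure_pmf.prob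
           (random_correspondence_assignment (complete_edges {1..n}) (l n))
           {(L, M). correspondence_colorable {1..n} (complete_edges {1..n}) L M})
      \<longlonglongrightarrow> 1"
proof -
  \<comment> \<open>With \<open>l = C * n / ln n\<close> the term \<open>exp (- 2 * n / l)\<close>
    is \<open>n\<close> to the power \<open>- 2 / C\<close>, so the exponent in
    \<open>prob_colorable_ge\<close> has order \<open>n\<close> to the power
    \<open>1 - 2 / C\<close>, divided by \<open>ln n\<close>. Any constant \<open>C > 2\<close>
    makes this outgrow \<open>ln n\<close>; the choice 4 produces a square root.\<close>
  define l where "l n = nat \<lceil>4 * real n / ln (real n)\<rceil>" for n
  have large: "eventually (\<lambda>n. 2 \<le> 4 * real n / ln (real n)) at_top"
    and pos: "eventually (\<lambda>n. ln (real n) > 0) at_top"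
    and one: "eventually (\<lambda>n. 1 \<le> real n / ln (real n)) at_top"
    by real_asymp+
  have lower: "4 * real n / ln (real n) \<le> real (l n)" for n
    unfolding l_def by linarith
  \<comment> \<open>Rounding up costs at most 1, which is at most \<open>n / ln n\<close> for large
    \<open>n\<close>; hence 5 in place of 4.\<close>
  have upper: "eventually (\<lambda>n. real (l n) \<le> 5 * (real n / ln (real n))) at_top"
    using one large
  proof eventually_elim
    case (elim n)
    then show ?case
      unfolding l_def by linarith
  qed
  have "(\<lambda>n. real (l n)) \<in> \<Theta>(\<lambda>n. real n / ln (real n))"
  proof (rule bigthetaI')
    show "eventually (\<lambda>n. 4 * norm (real n / ln (real n)) \<le> norm (real (l n)) \<and>
        norm (real (l n)) \<le> 5 * norm (real n / ln (real n))) at_top"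
      using upper pos
    proof eventually_elim
      case (elim n)
      then show ?case
        using lower[of n] by simp
    qed
  qed auto
  moreover have "(\<lambda>n. measure_pmf.prob
           (random_correspondence_assignment (complete_edges {1..n}) (l n))
           {(L, M). correspondence_colorable {1..n} (complete_edges {1..n}) L M}) \<longlonglongrightarrow> 1"
  proof (rule tendsto_sandwich)
    \<comment> \<open>Since \<open>l n\<close> is at least \<open>4 * n / ln n\<close>, both factors
      of the exponent in \<open>prob_colorable_ge\<close> can be bounded below, the second by
      \<open>exp (- ln n / 2)\<close>, that is \<open>1 / sqrt n\<close>. The upper side of the
      sandwich is the constant 1.\<close>
    show "eventually (\<lambda>n. 1 - real n * exp (- (4 * real n / ln (real n)) * exp (- ln (real n) / 2))
        \<le> measure_pmf.prob (random_correspondence_assignment (complete_edges {1..n}) (l n))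
           {(L, M). correspondence_colorable {1..n} (complete_edges {1..n}) L M}) at_top"
      using large pos
    proof eventually_elim
      case (elim n)
      have l2: "l n \<ge> 2"
        using elim lower[of n] by linarith
      have "4 * real n \<le> real (l n) * ln (real n)"
        using lower[of n] elim by (simp add: field_simps)
      then have "2 * real n / real (l n) \<le> ln (real n) / 2"
        using l2 by (simp add: field_simps)
      then have "(4 * real n / ln (real n)) * exp (- ln (real n) / 2)
          \<le> real (l n) * exp (- 2 * real n / real (l n))"
        using lower[of n] elim by (intro mult_mono) auto
      then have "real n * exp (- real (l n) * exp (- 2 * real n / real (l n)))
          \<le> real n * exp (- (4 * real n / ln (real n)) * exp (- ln (real n) / 2))"
        by (intro mult_left_mono) auto
      then show ?case
        using prob_colorable_ge[OF l2, of n] by linarith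
    qed
    show "(\<lambda>n. 1 - real n * exp (- (4 * real n / ln (real n)) * exp (- ln (real n) / 2))) \<longlonglongrightarrow> 1"
      by real_asymp
  qed auto
  ultimately show ?thesis
    by blast
qed

end
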